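(* Let $n$ be a positive integer and let $G$ be a simple graph. If $G$ is $n$-colourable, then $\mathbb{K}_k\text{-cover}_{\mathrm{f}}(G)\leq \frac{n}{k}$ for every integer $k$ with $1\leq k\leq \omega(G)$.
   Context: All graphs are finite and simple (no loops or multiple edges), with non-empty vertex set. $G$ is $n$-colourable if its vertices can be properly coloured using $n$ colours (adjacent vertices receive different colours). The clique number $\omega(G)$ is the largest number of vertices of $G$ inducing a complete subgraph. For an integer $k\geq 1$, $\mathbb{K}_k$ is the class of graphs not containing a $(k+1)$-clique. $\mathbb{K}_k(G)$ denotes the set of induced subgraphs of $G$ belonging to $\mathbb{K}_k$, and for $v\in V(G)$, $\mathbb{K}_k(G,v)$ denotes the set of those elements of $\mathbb{K}_k(G)$ that contain $v$. A fractional $\mathbb{K}_k$-cover of $G$ is a function $f:\mathbb{K}_k(G)\to[0,1]$ such that $\sum_{H\in\mathbb{K}_k(G,v)}f(H)\geq 1$ for every $v\in V(G)$. Its weight is $\sum_{H\in\mathbb{K}_k(G)}f(H)$. The fractional $\mathbb{K}_k$-cover number of $G$, denoted $\mathbb{K}_k\text{-cover}_{\mathrm{f}}(G)$, is the minimum weight over all fractional $\mathbb{K}_k$-covers of $G$. *)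

theory Defs
  imports "HOL-Analysis.Function_Topology" "Graph_Theory.Graph_Theory"
begin

text \<open>
  A finite simple graph is a graph in the sense of the locale \<^locale>\<open>graph\<close>: a finite loop-free
  digraph without parallel arcs whose adjacency relation is symmetric (each edge is a pair of opposite
  arcs). Since this locale allows the null graph, non-emptiness of the vertex set is required
  separately.
\<close>
definition simple_graph :: "('a, 'b) pre_digraph \<Rightarrow> bool" where
  "simple_graph G \<longleftrightarrow> graph G \<and> verts G \<noteq> {}"

definition colourable :: "nat \<Rightarrow> ('a, 'b) pre_digraph \<Rightarrow> bool" where
  "colourable n G \<longleftrightarrow>
     (\<exists>c :: 'a \<Rightarrow> nat. c \<in> verts G \<rightarrow> {..<n} \<and> (\<forall>u v. u \<rightarrow>\<^bsub>G\<^esub> v \<longrightarrow> c u \<noteq> c v))"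

definition cliques :: "nat \<Rightarrow> ('a, 'b) pre_digraph \<Rightarrow> 'a set set" where
  "cliques m G = {S. S \<subseteq> verts G \<and> complete_digraph m (G \<restriction> S)}"

definition clique_number :: "('a, 'b) pre_digraph \<Rightarrow> nat" where
  "clique_number G = Max {m. cliques m G \<noteq> {}}"

definition KK :: "nat \<Rightarrow> ('a, 'b) pre_digraph set" where
  "KK k = {H. simple_graph H \<and> cliques (k + 1) H = {}}"

definition KK_sub :: "nat \<Rightarrow> ('a, 'b) pre_digraph \<Rightarrow> ('a, 'b) pre_digraph set" where
  "KK_sub k G = {H \<in> KK k. induced_subgraph H G}"

definition KK_sub_at :: "nat \<Rightarrow> ('a, 'b) pre_digraph \<Rightarrow> 'a \<Rightarrow> ('a, 'b) pre_digraph set" where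
  "KK_sub_at k G v = {H \<in> KK_sub k G. v \<in> verts H}"

text \<open>Values of a cover outside \<^term>\<open>KK_sub k G\<close> are unconstrained and never used.\<close>
definition frac_cover :: "nat \<Rightarrow> ('a, 'b) pre_digraph \<Rightarrow> (('a, 'b) pre_digraph \<Rightarrow> real) \<Rightarrow> bool" where
  "frac_cover k G f \<longleftrightarrow>
     f \<in> KK_sub k G \<rightarrow> {0..1} \<and> (\<forall>v \<in> verts G. (\<Sum>H \<in> KK_sub_at k G v. f H) \<ge> 1)"

definition cover_weight :: "nat \<Rightarrow> ('a, 'b) pre_digraph \<Rightarrow> (('a, 'b) pre_digraph \<Rightarrow> real) \<Rightarrow> real" where
  "cover_weight k G f = (\<Sum>H \<in> KK_sub k G. f H)"

definition frac_cover_number :: "nat \<Rightarrow> ('a, 'b) pre_digraph \<Rightarrow> real" where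
  "frac_cover_number k G = (LEAST w. \<exists>f. frac_cover k G f \<and> w = cover_weight k G f)"

text \<open>
  The rest of the theory checks that the maximum and the minimum above exist, so that
  \<^const>\<open>clique_number\<close> and \<^const>\<open>frac_cover_number\<close> are not unspecified values.
\<close>

lemma finite_clique_sizes:
  assumes "simple_graph G"
  shows "finite {m. cliques m G \<noteq> {}}"
proof -
  interpret graph G using assms by (simp add: simple_graph_def)
  have "{m. cliques m G \<noteq> {}} \<subseteq> {..card (verts G)}"
    by (auto simp: cliques_def complete_digraph_def intro!: card_mono)
  then show ?thesis by (rule finite_subset) simp
qed

lemma clique_empty:
  assumes "simple_graph G"
  shows "{} \<in> cliques 0 G"
proof -
  have "graph (G \<restriction> {})"
    by unfold_locales (auto simp: symmetric_def arcs_ends_def sym_def)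
  then show ?thesis
    by (auto simp: cliques_def complete_digraph_def arcs_ends_def)
qed

lemma clique_number_attained:
  assumes "simple_graph G"
  shows "cliques (clique_number G) G \<noteq> {}"
    and "cliques m G \<noteq> {} \<Longrightarrow> m \<le> clique_number G"
proof -
  have "clique_number G \<in> {m. cliques m G \<noteq> {}}"
    unfolding clique_number_def
    by (rule Max_in) (use finite_clique_sizes[OF assms] clique_empty[OF assms] in auto)
  then show "cliques (clique_number G) G \<noteq> {}" by simp
  show "m \<le> clique_number G" if "cliques m G \<noteq> {}"
    unfolding clique_number_def using finite_clique_sizes[OF assms] that by (auto intro: Max_ge)
qed

lemma finite_KK_sub:
  assumes "simple_graph G"
  shows "finite (KK_sub k G)"
proof -
  interpret graph G using assms by (simp add: simple_graph_def)
  have "H = G \<restriction> verts H" if "induced_subgraph H G" for H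
    using that by (cases H) (auto simp: induced_subgraph_def subgraph_def compatible_def induce_subgraph_def)
  then have "KK_sub k G \<subseteq> (\<lambda>S. G \<restriction> S) ` Pow (verts G)"
    by (auto simp: KK_sub_def induced_subgraph_def subgraph_def)
  then show ?thesis by (rule finite_subset) simp
qed

lemma singleton_KK_sub_at:
  assumes "simple_graph G" "v \<in> verts G" "k \<ge> 1"
  shows "G \<restriction> {v} \<in> KK_sub_at k G v"
proof -
  interpret graph G using assms by (simp add: simple_graph_def)
  have "graph (G \<restriction> {v})"
  proof -
    have ind: "induced_subgraph (G \<restriction> {v}) G"
      using assms(2) induced_induce[of "{v}"] by simp
    from digraphI_induced[OF ind] induced_graph_imp_graph[OF ind] show ?thesis
      by (simp add: graph_def pseudo_graph_def digraph_def)
  qed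
  moreover have "cliques (k + 1) (G \<restriction> {v}) = {}"
  proof -
    have False if "S \<in> cliques (k + 1) (G \<restriction> {v})" for S
    proof -
      from that have "S \<subseteq> {v}" "card S = k + 1"
        by (simp_all add: cliques_def complete_digraph_def)
      then show False
        using card_mono[of "{v}" S] \<open>k \<ge> 1\<close> by simp
    qed
    then show ?thesis by blast
  qed
  ultimately show ?thesis
    using assms induced_induce[of "{v}"]
    by (auto simp: KK_sub_at_def KK_sub_def KK_def simple_graph_def)
qed

lemma frac_cover_number_attained:
  assumes "simple_graph G" "k \<ge> 1"
  shows "\<exists>f. frac_cover k G f \<and> frac_cover_number k G = cover_weight k G f
           \<and> (\<forall>g. frac_cover k G g \<longrightarrow> cover_weight k G f \<le> cover_weight k G g)"
proof -
  define C where "C = {f. \<forall>v \<in> verts G. (\<Sum>H \<in> KK_sub_at k G v. f H) \<ge> (1::real)}"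
  define B where "B = PiE UNIV (\<lambda>_ :: ('a, 'b) pre_digraph. {0..1::real})"
  have fin: "finite (KK_sub k G)" "finite (KK_sub_at k G v)" for v
    using finite_KK_sub[OF assms(1), of k] by (auto simp: KK_sub_at_def)
  have "compactin (product_topology (\<lambda>_. euclidean) UNIV) B"
    unfolding B_def by (simp add: compactin_PiE)
  then have "compact B" by (simp add: euclidean_product_topology)
  moreover have "closed C"
  proof -
    have *: "continuous_on UNIV (\<lambda>f. f H :: real)" for H :: "('a, 'b) pre_digraph"
      by (rule continuous_on_product_coordinates)
    have "closed {f. (\<Sum>H \<in> KK_sub_at k G v. f H) \<ge> (1::real)}" for v
      by (rule closed_Collect_le[OF continuous_on_const continuous_on_sum]) (rule *)
    then have "closed (\<Inter>v \<in> verts G. {f. (\<Sum>H \<in> KK_sub_at k G v. f H) \<ge> (1::real)})"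
      by (intro closed_INT) auto
    moreover have "C = (\<Inter>v \<in> verts G. {f. (\<Sum>H \<in> KK_sub_at k G v. f H) \<ge> (1::real)})"
      unfolding C_def by blast
    ultimately show ?thesis by simp
  qed
  ultimately have cpt: "compact (B \<inter> C)" by (rule compact_Int_closed)
  have cover: "frac_cover k G f" if "f \<in> B \<inter> C" for f
    using that by (auto simp: frac_cover_def B_def C_def PiE_def Pi_def)
  have "(\<lambda>_. 1) \<in> B \<inter> C"
  proof -
    have "(\<Sum>H \<in> KK_sub_at k G v. 1) \<ge> (1::real)" if "v \<in> verts G" for v
    proof -
      have "card (KK_sub_at k G v) > 0"
        using fin singleton_KK_sub_at[OF assms(1) that assms(2)] by (auto simp: card_gt_0_iff)
      then show ?thesis by simp
    qed
    then show ?thesis by (auto simp: B_def C_def)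
  qed
  then have "B \<inter> C \<noteq> {}" by blast
  moreover have "continuous_on (B \<inter> C) (cover_weight k G)"
    unfolding cover_weight_def[abs_def]
    by (intro continuous_on_sum continuous_on_subset[OF continuous_on_product_coordinates]) auto
  ultimately obtain f where f: "f \<in> B \<inter> C"
    and le: "\<And>g. g \<in> B \<inter> C \<Longrightarrow> cover_weight k G f \<le> cover_weight k G g"
    using continuous_attains_inf[OF cpt] by blast
  have min: "cover_weight k G f \<le> cover_weight k G g" if "frac_cover k G g" for g
  proof -
    let ?g = "\<lambda>H. if H \<in> KK_sub k G then g H else 0"
    have *: "(\<Sum>H \<in> KK_sub_at k G v. ?g H) = (\<Sum>H \<in> KK_sub_at k G v. g H)" for v
      by (rule sum.cong) (auto simp: KK_sub_at_def)
    have "?g \<in> B \<inter> C"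
      using that unfolding B_def C_def by (simp add: * frac_cover_def) (auto simp: Pi_def)
    from le[OF this] show ?thesis by (simp add: cover_weight_def)
  qed
  have "frac_cover_number k G = cover_weight k G f"
    unfolding frac_cover_number_def
    by (rule Least_equality) (use cover[OF f] min in auto)
  with cover[OF f] min show ?thesis by blast
qed

end

theory Submission
  imports Defs
begin

text \<open>
  Fix an \<open>n\<close>-colouring. Each set of \<open>k\<close> colours induces a \<open>k\<close>-colourable, hence
  \<open>(k + 1)\<close>-clique-free, subgraph. Among the \<open>n choose k\<close> such subgraphs every vertex lies in
  exactly \<open>(n - 1) choose (k - 1)\<close>, so weighting all of them equally gives a fractional cover of
  weight \<open>(n choose k) / ((n - 1) choose (k - 1)) = n / k\<close>.
\<close>

lemma sum_card_fibres:
  assumes "finite A" "finite B"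
  shows "(\<Sum>y \<in> B. card {x \<in> A. h x = y}) = card {x \<in> A. h x \<in> B}"
proof -
  have "(\<Sum>y \<in> B. card {x \<in> {x \<in> A. h x \<in> B}. h x = y}) = card {x \<in> A. h x \<in> B}"
    unfolding card_eq_sum by (rule sum.group) (use assms in auto)
  moreover have "{x \<in> {x \<in> A. h x \<in> B}. h x = y} = {x \<in> A. h x = y}" if "y \<in> B" for y
    using that by auto
  ultimately show ?thesis by simp
qed

text \<open>Deleting \<open>a\<close> is a bijection onto the subsets of \<open>A - {a}\<close> of
  size \<open>k - 1\<close>; \<open>insert a\<close> is its inverse.\<close>

lemma card_subsets_containing:
  assumes "finite A" "a \<in> A" "k \<ge> 1"
  shows "card {T. T \<subseteq> A \<and> card T = k \<and> a \<in> T} = (card A - 1) choose (k - 1)"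
proof -
  have "bij_betw (insert a) {T. T \<subseteq> A - {a} \<and> card T = k - 1} {T. T \<subseteq> A \<and> card T = k \<and> a \<in> T}"
  proof (rule bij_betw_byWitness[where f' = "\<lambda>T. T - {a}"])
    show "insert a ` {T. T \<subseteq> A - {a} \<and> card T = k - 1} \<subseteq> {T. T \<subseteq> A \<and> card T = k \<and> a \<in> T}"
    proof clarify
      fix T assume T: "T \<subseteq> A - {a}" "card T = k - 1"
      then have "finite T" "a \<notin> T" using assms(1) finite_subset by blast+
      with T assms show "insert a T \<subseteq> A \<and> card (insert a T) = k \<and> a \<in> insert a T" by auto
    qed
    show "(\<lambda>T. T - {a}) ` {T. T \<subseteq> A \<and> card T = k \<and> a \<in> T} \<subseteq> {T. T \<subseteq> A - {a} \<and> card T = k - 1}"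
      by auto
  qed auto
  then have "card {T. T \<subseteq> A \<and> card T = k \<and> a \<in> T} = card {T. T \<subseteq> A - {a} \<and> card T = k - 1}"
    by (simp add: bij_betw_same_card)
  also have "\<dots> = (card A - 1) choose (k - 1)"
    using assms by (simp add: n_subsets)
  finally show ?thesis .
qed

text \<open>Vertices of a clique are pairwise adjacent, so a proper colouring is injective on
  it.\<close>

lemma clique_card_le_colours:
  assumes "S \<in> cliques m G" "\<And>u v. u \<rightarrow>\<^bsub>G\<^esub> v \<Longrightarrow> c u \<noteq> c v" "c ` S \<subseteq> T" "finite T"
  shows "m \<le> card T"
proof -
  have "inj_on c S"
  proof (rule inj_onI, rule ccontr)
    fix u v assume "u \<in> S" "v \<in> S" "c u = c v" "u \<noteq> v"
    then have "u \<rightarrow>\<^bsub>G \<restriction> S\<^esub> v"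
      using assms(1) by (auto simp: cliques_def complete_digraph_def)
    then have "u \<rightarrow>\<^bsub>G\<^esub> v"
      by (auto simp: arcs_ends_def arc_to_ends_def)
    with assms(2) \<open>c u = c v\<close> show False by blast
  qed
  moreover have "card S = m"
    using assms(1) by (simp add: cliques_def complete_digraph_def)
  ultimately show ?thesis
    using assms(3,4) card_inj_on_le by blast
qed

text \<open>The colouring \<open>c\<close> stays proper on the induced subgraph and uses at most
  \<open>card T\<close> colours there, which rules out a clique of size \<open>k + 1\<close>. The
  vertex \<open>v\<close> makes the subgraph non-empty, as \<open>simple_graph\<close>
  demands.\<close>

lemma colour_classes_KK_sub:
  assumes "simple_graph G" "\<And>u v. u \<rightarrow>\<^bsub>G\<^esub> v \<Longrightarrow> c u \<noteq> c v"
    and "finite T" "card T \<le> k" "v \<in> verts G" "c v \<in> T"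
  shows "G \<restriction> {u \<in> verts G. c u \<in> T} \<in> KK_sub k G"
proof -
  interpret graph G using assms by (simp add: simple_graph_def)
  let ?S = "{u \<in> verts G. c u \<in> T}"
  have ind: "induced_subgraph (G \<restriction> ?S) G"
    by (rule induced_induce) auto
  have "graph (G \<restriction> ?S)"
    using digraphI_induced[OF ind] induced_graph_imp_graph[OF ind]
    by (simp add: graph_def pseudo_graph_def digraph_def)
  moreover have "cliques (k + 1) (G \<restriction> ?S) = {}"
  proof (rule ccontr)
    assume "cliques (k + 1) (G \<restriction> ?S) \<noteq> {}"
    then obtain S where S: "S \<in> cliques (k + 1) (G \<restriction> ?S)" by blast
    have "k + 1 \<le> card T"
    proof (rule clique_card_le_colours[OF S, where c = c])
      show "c u \<noteq> c w" if "u \<rightarrow>\<^bsub>G \<restriction> ?S\<^esub> w" for u w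
        using that assms(2)[of u w] by (auto simp: arcs_ends_def arc_to_ends_def)
      show "c ` S \<subseteq> T" using S by (auto simp: cliques_def)
    qed (rule assms(3))
    with assms(4) show False by simp
  qed
  ultimately show ?thesis
    using ind assms(5,6) by (auto simp: KK_sub_def KK_def simple_graph_def)
qed

text \<open>Giving each index weight \<open>1 / d\<close> covers every vertex with total weight
  exactly 1. The family is indexed so that \<open>h\<close> may repeat a subgraph or take values
  outside \<open>KK_sub k G\<close>.\<close>

lemma frac_cover_number_le_uniform_family:
  fixes h :: "'i \<Rightarrow> ('a, 'b) pre_digraph"
  assumes "simple_graph G" "k \<ge> 1" "finite I" "d > 0"
    and deg: "\<And>v. v \<in> verts G \<Longrightarrow> card {i \<in> I. h i \<in> KK_sub_at k G v} = d"
  shows "frac_cover_number k G \<le> card I / d"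
proof -
  \<comment> \<open>A subgraph that occurs for several indices collects the weight
    \<open>1 / d\<close> from each of them.\<close>
  define f where "f H = card {i \<in> I. h i = H} / d" for H
  have fin: "finite (KK_sub k G)"
    using assms(1) by (rule finite_KK_sub)
  have sum_f: "(\<Sum>H \<in> B. f H) = card {i \<in> I. h i \<in> B} / d" if "finite B" for B
    using sum_card_fibres[OF assms(3) that, of h]
    by (simp add: f_def flip: sum_divide_distrib of_nat_sum)
  have "f H \<in> {0..1}" if H: "H \<in> KK_sub k G" for H
  proof -
    obtain v where v: "v \<in> verts H" "v \<in> verts G"
      using H by (auto simp: KK_sub_def KK_def simple_graph_def induced_subgraph_def subgraph_def)
    \<comment> \<open>All members of the family equal to \<open>H\<close> are counted in the degree of \<open>v\<close>.\<close>
    have "card {i \<in> I. h i = H} \<le> card {i \<in> I. h i \<in> KK_sub_at k G v}"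
      using assms(3) H v by (intro card_mono) (auto simp: KK_sub_at_def)
    then show ?thesis using deg[OF v(2)] assms(4) by (simp add: f_def)
  qed
  moreover have "(\<Sum>H \<in> KK_sub_at k G v. f H) \<ge> 1" if "v \<in> verts G" for v
    using sum_f[of "KK_sub_at k G v"] fin deg[OF that] assms(4) by (simp add: KK_sub_at_def)
  ultimately have "frac_cover k G f"
    by (auto simp: frac_cover_def)
  then have "frac_cover_number k G \<le> cover_weight k G f"
    using frac_cover_number_attained[OF assms(1,2)] by metis
  also have "\<dots> = card {i \<in> I. h i \<in> KK_sub k G} / d"
    unfolding cover_weight_def by (rule sum_f[OF fin])
  \<comment> \<open>Indices whose subgraph lies outside \<open>KK_sub k G\<close> do not contribute
    to the weight.\<close>
  also have "\<dots> \<le> card I / d"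
    using assms(3) by (intro divide_right_mono) (auto intro: card_mono)
  finally show ?thesis .
qed

theorem theorem3p1:
  fixes n :: nat and G :: "('a, 'b) pre_digraph"
  assumes "n \<ge> 1"
    and "simple_graph G"
    and "colourable n G"
  shows "\<forall>k :: nat. 1 \<le> k \<and> k \<le> clique_number G \<longrightarrow>
           frac_cover_number k G \<le> real n / real k"
proof (intro allI impI, elim conjE)
  fix k assume k: "1 \<le> k" "k \<le> clique_number G"
  obtain c :: "'a \<Rightarrow> nat" where c: "c \<in> verts G \<rightarrow> {..<n}"
    and proper: "\<And>u v. u \<rightarrow>\<^bsub>G\<^esub> v \<Longrightarrow> c u \<noteq> c v"
    using assms(3) unfolding colourable_def by blast
  obtain S where S: "S \<in> cliques (clique_number G) G"
    using clique_number_attained(1)[OF assms(2)] by blast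
  \<comment> \<open>The resulting bound \<open>k \<le> n\<close> makes the binomial coefficient
    \<open>d\<close> positive.\<close>
  have "clique_number G \<le> card {..<n}"
    using S c by (intro clique_card_le_colours[OF S proper]) (auto simp: cliques_def)
  with k have "k \<le> n" by simp
  define I where "I = {T. T \<subseteq> {..<n} \<and> card T = k}"
  define h where "h T = G \<restriction> {u \<in> verts G. c u \<in> T}" for T
  define d where "d = (n - 1) choose (k - 1)"
  have "card {T \<in> I. h T \<in> KK_sub_at k G v} = d" if v: "v \<in> verts G" for v
  proof -
    \<comment> \<open>If no vertex has a colour in \<open>T\<close>, then \<open>h T\<close> is the
      null graph and not in \<open>KK_sub k G\<close>; \<open>c v \<in> T\<close> excludes this
      case.\<close>
    have "h T \<in> KK_sub_at k G v \<longleftrightarrow> c v \<in> T" if "T \<in> I" for T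
    proof -
      have T: "finite T" "card T \<le> k"
        using that by (auto simp: I_def intro: finite_subset)
      show ?thesis
        using colour_classes_KK_sub[of G c, OF assms(2) proper T v] v
        by (auto simp: KK_sub_at_def h_def)
    qed
    then have "{T \<in> I. h T \<in> KK_sub_at k G v} = {T. T \<subseteq> {..<n} \<and> card T = k \<and> c v \<in> T}"
      by (auto simp: I_def)
    moreover have "c v \<in> {..<n}" using c v by blast
    ultimately show ?thesis
      using card_subsets_containing[of "{..<n}" "c v" k] k(1) by (simp add: d_def)
  qed
  moreover have "finite I" by (simp add: I_def)
  moreover have "d > 0" using \<open>k \<le> n\<close> by (simp add: d_def)
  ultimately have "frac_cover_number k G \<le> card I / d"
    using frac_cover_number_le_uniform_family[OF assms(2) k(1)] by blast
  also have "card I = n choose k"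
    using n_subsets[of "{..<n}" k] by (simp add: I_def)
  also have "real (n choose k) / d = n / k"
  proof -
    \<comment> \<open>This is the absorption identity for binomial coefficients; it counts pairs of
      a \<open>k\<close>-set of colours and an element of it in two ways.\<close>
    have "k * (n choose k) = n * d"
      using times_binomial_minus1_eq[of k n] k(1) by (simp add: d_def)
    then have "real k * (n choose k) = real n * d"
      by (metis of_nat_mult)
    with \<open>d > 0\<close> k(1) show ?thesis by (simp add: field_simps)
  qed
  finally show "frac_cover_number k G \<le> real n / real k" .
qed

end
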